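(* For any $\epsilon\in(0,1/3]$, any (possibly randomized) distributed algorithm in the $\mathsf{BCC}$ model that determines a $(4/3-\epsilon)$-approximation of the radius of an unweighted $n$-node graph with probability at least $2/3$ requires $\widetilde{\Omega}(n)$ rounds.
   Context: Distributed setting: $n$ nodes with unique IDs in $\{1,\dots,n\}$; the input is an undirected unweighted graph on these nodes, each node initially knowing only its incident edges. In the broadcast congested clique $\mathsf{BCC}$, computation proceeds in synchronous rounds with unlimited local computation, and in each round every node broadcasts the same $\mathcal{O}(\log n)$-bit message to all other nodes. The eccentricity of $u$ is $\mathrm{ecc}(u)=\max_v d(u,v)$, the radius is $R=\min_u\mathrm{ecc}(u)$, and an $\alpha$-approximation is a value $\widetilde R$ with $R\le\widetilde R\le\alpha R$. $\widetilde{\Omega}$ hides polylogarithmic factors in $n$. *)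

theory Defs
  imports "HOL-Probability.Probability"
begin

definition graph_on :: "nat \<Rightarrow> (nat \<Rightarrow> nat \<Rightarrow> bool) \<Rightarrow> bool" where
  "graph_on n E \<longleftrightarrow> (\<forall>u v. E u v \<longrightarrow> u \<in> {1..n} \<and> v \<in> {1..n} \<and> u \<noteq> v \<and> E v u)"

definition nbrs :: "(nat \<Rightarrow> nat \<Rightarrow> bool) \<Rightarrow> nat \<Rightarrow> nat set" where
  "nbrs E v = {u. E v u}"

definition connected_graph :: "nat \<Rightarrow> (nat \<Rightarrow> nat \<Rightarrow> bool) \<Rightarrow> bool" where
  "connected_graph n E \<longleftrightarrow> (\<forall>u\<in>{1..n}. \<forall>v\<in>{1..n}. \<exists>k. (E ^^ k) u v)"

definition gdist :: "(nat \<Rightarrow> nat \<Rightarrow> bool) \<Rightarrow> nat \<Rightarrow> nat \<Rightarrow> nat" where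
  "gdist E u v = (LEAST k. (E ^^ k) u v)"

definition ecc :: "nat \<Rightarrow> (nat \<Rightarrow> nat \<Rightarrow> bool) \<Rightarrow> nat \<Rightarrow> nat" where
  "ecc n E u = Max ((\<lambda>v. gdist E u v) ` {1..n})"

definition radius :: "nat \<Rightarrow> (nat \<Rightarrow> nat \<Rightarrow> bool) \<Rightarrow> nat" where
  "radius n E = Min (ecc n E ` {1..n})"

text \<open>Node v draws a private random seed from alg_seed A v (independently of the
other nodes). In every round, node v broadcasts a message (a natural number) which
is an arbitrary function of its ID, its neighbourhood, its seed and the full
broadcast history so far (the list of all previous rounds; each round is the
vector of messages of all nodes). After the last round, node v outputs a real
number computed from the same data.\<close>
record bcc_alg =
  alg_seed :: "nat \<Rightarrow> nat pmf"
  alg_msg  :: "nat \<Rightarrow> nat set \<Rightarrow> nat \<Rightarrow> (nat \<Rightarrow> nat) list \<Rightarrow> nat"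
  alg_out  :: "nat \<Rightarrow> nat set \<Rightarrow> nat \<Rightarrow> (nat \<Rightarrow> nat) list \<Rightarrow> real"

primrec transcript ::
  "bcc_alg \<Rightarrow> nat \<Rightarrow> (nat \<Rightarrow> nat \<Rightarrow> bool) \<Rightarrow> (nat \<Rightarrow> nat) \<Rightarrow> nat \<Rightarrow> (nat \<Rightarrow> nat) list" where
  "transcript A n E s 0 = []"
| "transcript A n E s (Suc t) =
     (let h = transcript A n E s t
      in h @ [\<lambda>v. if v \<in> {1..n} then alg_msg A v (nbrs E v) (s v) h else 0])"

text \<open>Bandwidth: every message has at most c * log2 n bits.\<close>
definition bcc_bandwidth :: "real \<Rightarrow> nat \<Rightarrow> bcc_alg \<Rightarrow> bool" where
  "bcc_bandwidth c n A \<longleftrightarrow>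
     (\<forall>v N r h. v \<in> {1..n} \<longrightarrow> real (alg_msg A v N r h) < 2 powr (c * log 2 (real n)))"

definition seeds :: "nat \<Rightarrow> bcc_alg \<Rightarrow> (nat \<Rightarrow> nat) pmf" where
  "seeds n A = Pi_pmf {1..n} 0 (alg_seed A)"

definition bcc_radius_approx :: "nat \<Rightarrow> real \<Rightarrow> bcc_alg \<Rightarrow> nat \<Rightarrow> bool" where
  "bcc_radius_approx n \<alpha> A T \<longleftrightarrow>
     (\<forall>E. graph_on n E \<and> connected_graph n E \<longrightarrow>
        measure_pmf.prob (seeds n A)
          {s. \<forall>v\<in>{1..n}.
                let Rt = alg_out A v (nbrs E v) (s v) (transcript A n E s T)
                in real (radius n E) \<le> Rt \<and> Rt \<le> \<alpha> * real (radius n E)} \<ge> 2/3)"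

end

theory Submission
  imports Defs
begin

text \<open>
  Set disjointness on \<open>m\<^sup>2\<close> bits, with \<open>m = \<Theta>(n)\<close>, is encoded in a graph on \<open>n\<close> vertices in such a way
  that the radius is at most 3 if the two sets intersect and at least 4 otherwise, and the
  neighbourhood of each vertex depends on at most one of the two sets. After fixing the random seeds
  by averaging, \<open>T\<close> rounds amount to a two-party protocol with \<open>O(T n log n)\<close> bits, so it remains to
  see that disjointness of \<open>N\<close> bits costs \<open>\<Omega>(N)\<close> bits.

  On disjoint inputs that are uniform on complementary sets of coordinates, every transcript
  corresponds to a rectangle. By the level-one inequality, a set of density \<open>\<delta>\<close> in a cube has squared
  coordinate biases summing to \<open>O(ln (1/\<delta>))\<close>; averaged over transcripts this is at most the entropy of
  the transcript. Hence for a typical coordinate the transcript distributions for the bit pairs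
  \<open>(0,0)\<close>, \<open>(1,0)\<close> and \<open>(0,1)\<close> are close in Hellinger distance, unless the transcript is long. Since the
  distance between \<open>(0,0)\<close> and \<open>(1,1)\<close> equals that between \<open>(1,0)\<close> and \<open>(0,1)\<close>, a short
  protocol cannot recognise a common element.
\<close>

section \<open>The level-one inequality and entropy\<close>

text \<open>Points of the cube are encoded as subsets of \<open>S\<close>: elements are coordinates
  and \<open>insert i\<close> sets a bit. The value is the expectation under the uniform
  measure.\<close>

definition avg :: "'a set \<Rightarrow> ('a set \<Rightarrow> real) \<Rightarrow> real" where
  "avg S g = (\<Sum>x\<in>Pow S. g x) / 2 ^ card S"

lemma sum_Pow_insert:
  fixes g :: "'a set \<Rightarrow> 'b::comm_monoid_add"
  assumes "finite S" "i \<notin> S"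
  shows "(\<Sum>x\<in>Pow (insert i S). g x) = (\<Sum>x\<in>Pow S. g x) + (\<Sum>x\<in>Pow S. g (insert i x))"
proof -
  have "inj_on (insert i) (Pow S)"
    using assms(2) by (auto simp: inj_on_def)
  then have "sum g (insert i ` Pow S) = (\<Sum>x\<in>Pow S. g (insert i x))"
    by (simp add: sum.reindex)
  moreover have "Pow S \<inter> insert i ` Pow S = {}"
    using assms(2) by auto
  ultimately show ?thesis
    using assms by (simp add: Pow_insert sum.union_disjoint)
qed

lemma avg_insert:
  assumes "finite S" "i \<notin> S"
  shows "avg (insert i S) g = (avg S g + avg S (\<lambda>x. g (insert i x))) / 2"
  using assms by (simp add: avg_def sum_Pow_insert add_divide_distrib)

lemma exp_le_quadratic:
  fixes x :: real
  assumes "\<bar>x\<bar> \<le> 1"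
  shows "exp x \<le> 1 + x + x\<^sup>2"
proof (cases "x \<ge> 0")
  case True
  with assms show ?thesis by (intro exp_bound) auto
next
  case False
  define y where "y = - x"
  have y: "0 \<le> y" "y \<le> 1" using False assms by (auto simp: y_def)
  \<comment> \<open>The product is 1 + y^3.\<close>
  have "1 \<le> (1 - y + y\<^sup>2) * (1 + y)"
    using y by (simp add: power2_eq_square algebra_simps)
  also have "\<dots> \<le> (1 - y + y\<^sup>2) * exp y"
  proof (rule mult_left_mono)
    show "0 \<le> 1 - y + y\<^sup>2" using y by (smt (verit) zero_le_power2)
  qed simp
  finally have "exp (- y) \<le> 1 - y + y\<^sup>2"
    by (simp add: exp_minus field_simps)
  then show ?thesis by (simp add: y_def)
qed

text \<open>Moment generating function of a sum of independent random signs: it factors over the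
  coordinates, and each factor is cosh (w i) <= 1 + (w i)^2 <= exp ((w i)^2).\<close>

lemma avg_exp_le:
  assumes "finite S" "\<And>i. i \<in> S \<Longrightarrow> \<bar>w i\<bar> \<le> 1"
  shows "avg S (\<lambda>x. exp (\<Sum>i\<in>S. w i * (if i \<in> x then 1 else -1))) \<le> exp (\<Sum>i\<in>S. (w i)\<^sup>2)"
  using assms
proof (induction S rule: finite_induct)
  case empty
  then show ?case by (simp add: avg_def)
next
  case (insert i S)
  let ?f = "\<lambda>x. exp (\<Sum>j\<in>S. w j * (if j \<in> x then 1 else -1))"
  have "exp (w i) + exp (- w i) \<le> 2 * (1 + (w i)\<^sup>2)"
    using exp_le_quadratic[of "w i"] exp_le_quadratic[of "- w i"] insert.prems by simp
  also have "\<dots> \<le> 2 * exp ((w i)\<^sup>2)"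
    by (intro mult_left_mono exp_ge_add_one_self) auto
  finally have *: "(exp (w i) + exp (- w i)) / 2 \<le> exp ((w i)\<^sup>2)" by simp
  have f0: "exp (\<Sum>j\<in>insert i S. w j * (if j \<in> x then 1 else -1)) = exp (- w i) * ?f x"
    if "x \<in> Pow S" for x
    using that insert.hyps by (auto simp: exp_add)
  have f1: "exp (\<Sum>j\<in>insert i S. w j * (if j \<in> insert i x then 1 else -1)) = exp (w i) * ?f x"
    if "x \<in> Pow S" for x
  proof -
    have "(\<Sum>j\<in>S. w j * (if j \<in> insert i x then 1 else -1)) = (\<Sum>j\<in>S. w j * (if j \<in> x then 1 else -1))"
      using insert.hyps by (intro sum.cong) auto
    then show ?thesis using insert.hyps by (simp add: exp_add)
  qed
  have "avg (insert i S) (\<lambda>x. exp (\<Sum>j\<in>insert i S. w j * (if j \<in> x then 1 else -1)))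
      = (exp (w i) + exp (- w i)) / 2 * avg S ?f"
  proof -
    have "(\<Sum>x\<in>Pow S. exp (\<Sum>j\<in>insert i S. w j * (if j \<in> x then 1 else -1))) = exp (- w i) * sum ?f (Pow S)"
      "(\<Sum>x\<in>Pow S. exp (\<Sum>j\<in>insert i S. w j * (if j \<in> insert i x then 1 else -1))) = exp (w i) * sum ?f (Pow S)"
      unfolding sum_distrib_left by (intro sum.cong refl f0 f1; assumption)+
    then show ?thesis
      unfolding avg_insert[OF insert.hyps(1,2)] unfolding avg_def
      using insert.hyps(1,2) by (simp only: card_insert_disjoint power_Suc) (simp add: field_simps)
  qed
  also have "\<dots> \<le> exp ((w i)\<^sup>2) * exp (\<Sum>j\<in>S. (w j)\<^sup>2)"
    using * insert.IH insert.prems by (intro mult_mono) (auto simp: avg_def sum_nonneg)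
  also have "\<dots> = exp (\<Sum>j\<in>insert i S. (w j)\<^sup>2)"
    using insert.hyps by (simp add: exp_add)
  finally show ?case .
qed

text \<open>The quotient for \<open>i\<close> is the mean of the i-th sign over a uniform point of
  \<open>F\<close>. The linear form weighted by half these means has mean \<open>W / 2\<close> on
  \<open>F\<close>, so by convexity its exponential has mean at least \<open>exp (W / 2)\<close>
  there. Over the whole cube this leaves at least \<open>exp (W / 2)\<close> times the density of
  \<open>F\<close>, while \<open>avg_exp_le\<close> allows at most
  \<open>exp (W / 4)\<close>.\<close>

lemma level_one_inequality:
  fixes F :: "'a set set"
  assumes S: "finite S" and pos: "avg S (indicator F) > 0"
  shows "(\<Sum>i\<in>S. ((avg (S - {i}) (\<lambda>x. indicator F (insert i x)) - avg (S - {i}) (indicator F)) /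
            (avg (S - {i}) (\<lambda>x. indicator F (insert i x)) + avg (S - {i}) (indicator F)))\<^sup>2)
         \<le> 4 * ln (1 / avg S (indicator F))"
proof -
  let ?G = "Pow S \<inter> F"
  let ?s = "\<lambda>i x. if i \<in> x then 1 else -1 :: real"
  define w where "w = (\<lambda>i. (\<Sum>x\<in>?G. ?s i x) / real (card ?G))"
  have ind: "(\<Sum>x\<in>Pow S. indicator F x * g x) = (\<Sum>x\<in>?G. g x)" for g :: "'a set \<Rightarrow> real"
    unfolding sum.inter_restrict[OF finite_Pow_iff[THEN iffD2, OF S]]
    by (intro sum.cong) (auto simp: indicator_def)
  have a: "avg S (indicator F) = card ?G / 2 ^ card S"
    using ind[of "\<lambda>_. 1"] by (simp add: avg_def)
  then have G: "card ?G > 0" using pos by (simp add: zero_less_divide_iff)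
  have w: "w i = (avg (S - {i}) (\<lambda>x. indicator F (insert i x)) - avg (S - {i}) (indicator F)) /
            (avg (S - {i}) (\<lambda>x. indicator F (insert i x)) + avg (S - {i}) (indicator F))"
    if "i \<in> S" for i
  proof -
    have Si: "insert i (S - {i}) = S" using that by auto
    have 1: "avg S (\<lambda>x. indicator F x * ?s i x) =
        (avg (S - {i}) (\<lambda>x. indicator F (insert i x)) - avg (S - {i}) (indicator F)) / 2"
    proof -
      have "avg (S - {i}) (\<lambda>x. indicator F x * ?s i x) = avg (S - {i}) (\<lambda>x. - indicator F x)"
        unfolding avg_def by (intro arg_cong2[where f="(/)"] sum.cong) auto
      then show ?thesis
        using avg_insert[of "S - {i}" i "\<lambda>x. indicator F x * ?s i x"] S Si
        by (simp add: avg_def sum_negf)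
    qed
    have 2: "avg S (indicator F) =
        (avg (S - {i}) (\<lambda>x. indicator F (insert i x)) + avg (S - {i}) (indicator F)) / 2"
      using avg_insert[of "S - {i}" i "indicator F"] S Si by simp
    have "w i = avg S (\<lambda>x. indicator F x * ?s i x) / avg S (indicator F)"
      unfolding a unfolding avg_def ind w_def by simp
    also have "\<dots> = (2 * avg S (\<lambda>x. indicator F x * ?s i x)) / (2 * avg S (indicator F))"
      by (rule mult_divide_mult_cancel_left[symmetric]) simp
    finally show ?thesis unfolding 1 2 by (simp only: mult_2 field_sum_of_halves)
  qed
  have w1: "\<bar>w i / 2\<bar> \<le> 1" for i
  proof -
    have "\<bar>\<Sum>x\<in>?G. ?s i x\<bar> \<le> (\<Sum>x\<in>?G. \<bar>?s i x\<bar>)" by (rule sum_abs)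
    also have "\<dots> = (\<Sum>x\<in>?G. 1)" by (rule sum.cong) auto
    also have "\<dots> = card ?G" by simp
    finally show ?thesis using G by (simp add: w_def field_simps)
  qed
  \<comment> \<open>Weights \<open>l * w i\<close> would bound \<open>(l - l^2) * W\<close> by the
    logarithm of the inverse density; l = 1/2 is the best choice.\<close>
  define L where "L = (\<lambda>x. \<Sum>i\<in>S. w i / 2 * ?s i x)"
  define W where "W = (\<Sum>i\<in>S. (w i)\<^sup>2)"
  have "(\<Sum>x\<in>?G. L x) = (\<Sum>i\<in>S. w i / 2 * (\<Sum>x\<in>?G. ?s i x))"
    unfolding L_def by (subst sum.swap) (simp add: sum_distrib_left)
  also have "\<dots> = (\<Sum>i\<in>S. card ?G * (w i)\<^sup>2 / 2)"
    using G by (intro sum.cong) (auto simp: w_def power2_eq_square)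
  finally have sumL: "(\<Sum>x\<in>?G. L x) = card ?G * (W / 2)"
    by (simp add: W_def sum_distrib_left sum_divide_distrib)
  \<comment> \<open>Jensen's inequality, through the tangent of \<open>exp\<close> at the mean
    \<open>W / 2\<close>.\<close>
  have "real (card ?G) * exp (W / 2) = (\<Sum>x\<in>?G. exp (W / 2) * (1 + (L x - W / 2)))"
    by (simp add: sum_distrib_left[symmetric] sum.distrib sum_subtractf sumL)
  also have "\<dots> \<le> (\<Sum>x\<in>?G. exp (W / 2) * exp (L x - W / 2))"
    by (intro sum_mono mult_left_mono exp_ge_add_one_self) auto
  also have "\<dots> = (\<Sum>x\<in>?G. exp (L x))"
    by (simp flip: exp_add)
  also have "\<dots> \<le> (\<Sum>x\<in>Pow S. exp (L x))"
    using S by (intro sum_mono2) auto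
  also have "\<dots> \<le> 2 ^ card S * exp (\<Sum>i\<in>S. (w i / 2)\<^sup>2)"
    using avg_exp_le[OF S, of "\<lambda>i. w i / 2"] w1 unfolding L_def avg_def by (simp add: field_simps)
  also have "(\<Sum>i\<in>S. (w i / 2)\<^sup>2) = W / 4"
    by (simp add: W_def power_divide sum_divide_distrib)
  finally have "avg S (indicator F) * exp (W / 2) \<le> exp (W / 4)"
    by (simp add: a field_simps)
  then have "ln (avg S (indicator F) * exp (W / 2)) \<le> W / 4"
    using pos by (metis exp_gt_zero ln_exp ln_le_cancel_iff mult_pos_pos)
  then have "W \<le> 4 * ln (1 / avg S (indicator F))"
    using pos by (simp add: ln_mult ln_div)
  then show ?thesis by (simp add: W_def w)
qed

text \<open>Gibbs' inequality against the uniform distribution: ln z <= z - 1 in each term, and the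
  resulting bounds sum to 1 - 1.\<close>

lemma entropy_le_ln_card:
  fixes p :: "'t \<Rightarrow> real"
  assumes fin: "finite I" and nn: "\<And>t. t \<in> I \<Longrightarrow> p t \<ge> 0" and sum1: "sum p I = 1"
  shows "(\<Sum>t\<in>I. p t * ln (1 / p t)) \<le> ln (card I)"
proof -
  have "I \<noteq> {}" using sum1 by auto
  then have K: "real (card I) > 0" using fin by (simp add: card_gt_0_iff)
  have "p t * ln (1 / p t) - p t * ln (card I) \<le> 1 / card I - p t" if "t \<in> I" for t
  proof (cases "p t = 0")
    case False
    then have pt: "p t > 0" using nn[OF that] by simp
    have "p t * ln (1 / (p t * card I)) \<le> p t * (1 / (p t * card I) - 1)"
      using pt K by (intro mult_left_mono ln_le_minus_one) auto
    then show ?thesis using pt K by (simp add: ln_div ln_mult algebra_simps)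
  qed simp
  then have "(\<Sum>t\<in>I. p t * ln (1 / p t) - p t * ln (card I)) \<le> (\<Sum>t\<in>I. 1 / card I - p t)"
    by (rule sum_mono)
  then show ?thesis
    using K by (simp add: sum_subtractf sum1 flip: sum_distrib_right)
qed

section \<open>Communication complexity of set disjointness\<close>

text \<open>Replaces Hellinger terms by the rational expressions that the level-one inequality
  controls. The reason is a + b <= (sqrt a + sqrt b)^2.\<close>

lemma sqrt_diff_square_le:
  fixes a b :: real
  assumes "a \<ge> 0" "b \<ge> 0"
  shows "(sqrt a - sqrt b)\<^sup>2 \<le> (a - b)\<^sup>2 / (a + b)"
proof (cases "a + b = 0")
  case True
  then have "a = 0" "b = 0" using assms by auto
  then show ?thesis by simp
next
  case False
  then have p: "a + b > 0" using assms by simp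
  define u v where "u = sqrt a" and "v = sqrt b"
  have ab: "a = u\<^sup>2" "b = v\<^sup>2" and uv: "u \<ge> 0" "v \<ge> 0" using assms by (auto simp: u_def v_def)
  have "a + b \<le> (u + v)\<^sup>2" using uv by (simp add: ab power2_sum)
  then have "(u - v)\<^sup>2 * (a + b) \<le> (u - v)\<^sup>2 * (u + v)\<^sup>2"
    by (intro mult_left_mono) auto
  also have "\<dots> = (a - b)\<^sup>2"
    by (simp add: ab power2_eq_square algebra_simps)
  finally show ?thesis using p by (simp add: u_def v_def field_simps)
qed

text \<open>The middle step is the cut-and-paste property:
  \<open>(\<alpha>\<^sub>0\<beta>\<^sub>0)(\<alpha>\<^sub>1\<beta>\<^sub>1) = (\<alpha>\<^sub>1\<beta>\<^sub>0)(\<alpha>\<^sub>0\<beta>\<^sub>1)\<close>, so the Hellinger distance between the two diagonal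
  distributions equals that between the two off-diagonal ones.\<close>
lemma cut_and_paste_bound:
  fixes \<alpha>0 \<alpha>1 \<beta>0 \<beta>1 :: "'t \<Rightarrow> real"
  assumes nn: "\<And>t. \<alpha>0 t \<ge> 0" "\<And>t. \<alpha>1 t \<ge> 0" "\<And>t. \<beta>0 t \<ge> 0" "\<And>t. \<beta>1 t \<ge> 0"
    and s: "(\<Sum>t\<in>I. \<alpha>0 t * \<beta>0 t) = 1" "(\<Sum>t\<in>I. \<alpha>1 t * \<beta>1 t) = 1"
       "(\<Sum>t\<in>I. \<alpha>1 t * \<beta>0 t) = 1" "(\<Sum>t\<in>I. \<alpha>0 t * \<beta>1 t) = 1"
  shows "(\<Sum>t\<in>I. \<bar>\<alpha>0 t * \<beta>0 t - \<alpha>1 t * \<beta>1 t\<bar>) \<le> 1 / 6 + 12 *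
     (\<Sum>t\<in>I. \<beta>0 t * ((\<alpha>1 t - \<alpha>0 t)\<^sup>2 / (\<alpha>1 t + \<alpha>0 t)) + \<alpha>0 t * ((\<beta>1 t - \<beta>0 t)\<^sup>2 / (\<beta>1 t + \<beta>0 t)))"
    (is "_ \<le> _ + 12 * ?\<eta>")
proof -
  define a0 a1 b0 b1 where "a0 t = sqrt (\<alpha>0 t)" "a1 t = sqrt (\<alpha>1 t)"
    "b0 t = sqrt (\<beta>0 t)" "b1 t = sqrt (\<beta>1 t)" for t
  note d = this
  have sq: "\<alpha>0 t = (a0 t)\<^sup>2" "\<alpha>1 t = (a1 t)\<^sup>2" "\<beta>0 t = (b0 t)\<^sup>2" "\<beta>1 t = (b1 t)\<^sup>2" for t
    using nn by (auto simp: d)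
  have pos: "a0 t \<ge> 0" "a1 t \<ge> 0" "b0 t \<ge> 0" "b1 t \<ge> 0" for t
    using nn by (auto simp: d)
  have "\<bar>\<alpha>0 t * \<beta>0 t - \<alpha>1 t * \<beta>1 t\<bar> \<le>
      6 * (a0 t * b0 t - a1 t * b1 t)\<^sup>2 + (\<alpha>0 t * \<beta>0 t + \<alpha>1 t * \<beta>1 t) / 12" for t
  proof -
    define u v where "u = a0 t * b0 t" and "v = a1 t * b1 t"
    have uv: "u \<ge> 0" "v \<ge> 0" by (auto simp: u_def v_def pos)
    have "\<bar>\<alpha>0 t * \<beta>0 t - \<alpha>1 t * \<beta>1 t\<bar> = \<bar>u - v\<bar> * (u + v)"
    proof -
      have "\<alpha>0 t * \<beta>0 t - \<alpha>1 t * \<beta>1 t = (u - v) * (u + v)"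
        unfolding sq u_def v_def by (simp add: power2_eq_square algebra_simps)
      then show ?thesis using uv by (simp add: abs_mult)
    qed
    \<comment> \<open>AM-GM, balanced so that the second term sums to at most 1/6 over all
      transcripts, half of the gap 1/3 assumed in the disjointness bound.\<close>
    also have "\<dots> \<le> 6 * \<bar>u - v\<bar>\<^sup>2 + (u + v)\<^sup>2 / 24"
    proof -
      have "12 * (\<bar>u - v\<bar> * (u + v)) \<le> 72 * \<bar>u - v\<bar>\<^sup>2 + (u + v)\<^sup>2 / 2"
        using zero_le_power2[of "12 * \<bar>u - v\<bar> - (u + v)"]
        unfolding power2_diff power_mult_distrib by simp
      then show ?thesis by simp
    qed
    also have "(u + v)\<^sup>2 / 24 \<le> (u\<^sup>2 + v\<^sup>2) / 12"
      using zero_le_power2[of "u - v"] by (simp add: power2_eq_square algebra_simps)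
    finally show ?thesis by (simp add: u_def v_def sq power_mult_distrib)
  qed
  then have "(\<Sum>t\<in>I. \<bar>\<alpha>0 t * \<beta>0 t - \<alpha>1 t * \<beta>1 t\<bar>) \<le>
      (\<Sum>t\<in>I. 6 * (a0 t * b0 t - a1 t * b1 t)\<^sup>2 + (\<alpha>0 t * \<beta>0 t + \<alpha>1 t * \<beta>1 t) / 12)"
    by (intro sum_mono)
  also have "\<dots> = 6 * (\<Sum>t\<in>I. (a0 t * b0 t - a1 t * b1 t)\<^sup>2) + 1 / 6"
    by (simp add: sum.distrib s flip: sum_distrib_left sum_divide_distrib)
  also have "(\<Sum>t\<in>I. (a0 t * b0 t - a1 t * b1 t)\<^sup>2) = (\<Sum>t\<in>I. (a1 t * b0 t - a0 t * b1 t)\<^sup>2)"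
  proof -
    have "(\<Sum>t\<in>I. (a0 t * b0 t - a1 t * b1 t)\<^sup>2) =
        (\<Sum>t\<in>I. \<alpha>0 t * \<beta>0 t + \<alpha>1 t * \<beta>1 t - 2 * (a0 t * a1 t * b0 t * b1 t))"
      unfolding sq by (intro sum.cong) (auto simp: power2_eq_square algebra_simps)
    moreover have "(\<Sum>t\<in>I. (a1 t * b0 t - a0 t * b1 t)\<^sup>2) =
        (\<Sum>t\<in>I. \<alpha>1 t * \<beta>0 t + \<alpha>0 t * \<beta>1 t - 2 * (a0 t * a1 t * b0 t * b1 t))"
      unfolding sq by (intro sum.cong) (auto simp: power2_eq_square algebra_simps)
    ultimately show ?thesis by (simp add: sum.distrib sum_subtractf s)
  qed
  also have "(\<Sum>t\<in>I. (a1 t * b0 t - a0 t * b1 t)\<^sup>2) \<le> 2 * ?\<eta>"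
    unfolding sum_distrib_left
  proof (rule sum_mono)
    fix t
    \<comment> \<open>Passing through \<open>a0 t * b0 t\<close> changes one player's bit at a
      time.\<close>
    have "(a1 t * b0 t - a0 t * b1 t)\<^sup>2 \<le>
        2 * ((b0 t)\<^sup>2 * (a1 t - a0 t)\<^sup>2 + (a0 t)\<^sup>2 * (b1 t - b0 t)\<^sup>2)"
      using zero_le_power2[of "b0 t * (a1 t - a0 t) + a0 t * (b1 t - b0 t)"]
      by (simp add: power2_eq_square algebra_simps)
    also have "\<dots> \<le> 2 * (\<beta>0 t * ((\<alpha>1 t - \<alpha>0 t)\<^sup>2 / (\<alpha>1 t + \<alpha>0 t)) +
        \<alpha>0 t * ((\<beta>1 t - \<beta>0 t)\<^sup>2 / (\<beta>1 t + \<beta>0 t)))"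
      using sqrt_diff_square_le[OF nn(2) nn(1), of t t] sqrt_diff_square_le[OF nn(4) nn(3), of t t]
      unfolding sq[symmetric]
      by (intro mult_left_mono add_mono) (auto simp: nn d)
    finally show "(a1 t * b0 t - a0 t * b1 t)\<^sup>2 \<le> \<dots>" .
  qed
  finally show ?thesis by simp
qed

lemma avg_nonneg: "(\<And>x. g x \<ge> 0) \<Longrightarrow> avg S g \<ge> 0"
  by (simp add: avg_def sum_nonneg)

text \<open>Passes from sums over input pairs to sums over transcripts: each transcript contributes
  a product function of the two inputs, so its double sum factors.\<close>

lemma avg_mult_avg_eq_sum:
  assumes rect: "\<And>x y. (\<Sum>t\<in>I. c t * (f t x * g t y)) = q x y"
  shows "(\<Sum>x\<in>Pow S. \<Sum>y\<in>Pow S'. q x y) =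
         2 ^ (card S + card S') * (\<Sum>t\<in>I. c t * (avg S (f t) * avg S' (g t)))"
proof -
  have "avg S (f t) * avg S' (g t) =
      (\<Sum>x\<in>Pow S. \<Sum>y\<in>Pow S'. f t x * g t y) / (2 ^ card S * 2 ^ card S')" for t
    by (simp add: avg_def sum_product)
  then have "(\<Sum>t\<in>I. c t * (avg S (f t) * avg S' (g t))) =
      (\<Sum>t\<in>I. \<Sum>x\<in>Pow S. \<Sum>y\<in>Pow S'. c t * (f t x * g t y)) / (2 ^ card S * 2 ^ card S')"
    by (simp add: sum_divide_distrib sum_distrib_left)
  also have "(\<Sum>t\<in>I. \<Sum>x\<in>Pow S. \<Sum>y\<in>Pow S'. c t * (f t x * g t y)) =
      (\<Sum>x\<in>Pow S. \<Sum>y\<in>Pow S'. \<Sum>t\<in>I. c t * (f t x * g t y))"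
    by (subst sum.swap, rule sum.cong[OF refl], subst sum.swap) simp
  finally show ?thesis by (simp add: rect power_add)
qed

lemma sum_avg_mult_avg:
  assumes "finite S" "finite S'" and one: "\<And>x y. (\<Sum>t\<in>I. f t x * g t y) = 1"
  shows "(\<Sum>t\<in>I. avg S (f t) * avg S' (g t)) = 1"
  using avg_mult_avg_eq_sum[where c="\<lambda>_. 1" and q="\<lambda>_ _. 1" and f=f and g=g and I=I and S=S and S'=S'] assms
  by (simp add: card_Pow power_add)

text \<open>The level-one inequality applies to both sides of each rectangle. The two logarithms add
  up to that of the inverse probability of the transcript, so the total is at most four times the
  transcript entropy.\<close>

lemma information_bound:
  fixes A B :: "'t \<Rightarrow> 'a set set"
  assumes fin: "finite I" "finite S" "finite S'"
    and one: "\<And>x y. (\<Sum>t\<in>I. indicator (A t) x * indicator (B t) y :: real) = 1"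
  shows "(\<Sum>t\<in>I. avg S (indicator (A t)) * avg S' (indicator (B t)) *
     ((\<Sum>i\<in>S. ((avg (S - {i}) (\<lambda>x. indicator (A t) (insert i x)) - avg (S - {i}) (indicator (A t))) /
            (avg (S - {i}) (\<lambda>x. indicator (A t) (insert i x)) + avg (S - {i}) (indicator (A t))))\<^sup>2) +
      (\<Sum>i\<in>S'. ((avg (S' - {i}) (\<lambda>x. indicator (B t) (insert i x)) - avg (S' - {i}) (indicator (B t))) /
            (avg (S' - {i}) (\<lambda>x. indicator (B t) (insert i x)) + avg (S' - {i}) (indicator (B t))))\<^sup>2)))
    \<le> 4 * ln (card I)" (is "(\<Sum>t\<in>I. ?a t * ?b t * (?X t + ?Y t)) \<le> _")
proof -
  have nn: "?a t \<ge> 0" "?b t \<ge> 0" for t by (auto intro!: avg_nonneg)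
  have "?a t * ?b t * (?X t + ?Y t) \<le> 4 * (?a t * ?b t * ln (1 / (?a t * ?b t)))" for t
  \<comment> \<open>The level-one inequality needs positive density; transcripts of probability zero
    contribute nothing.\<close>
  proof (cases "?a t * ?b t = 0")
    case False
    then have p: "?a t > 0" "?b t > 0" using nn[of t] by (auto simp: less_le)
    have "?X t + ?Y t \<le> 4 * ln (1 / ?a t) + 4 * ln (1 / ?b t)"
      using p fin by (intro add_mono level_one_inequality)
    also have "\<dots> = 4 * ln (1 / (?a t * ?b t))"
      using p by (simp add: ln_div ln_mult)
    finally have "?X t + ?Y t \<le> 4 * ln (1 / (?a t * ?b t))" .
    then have "?a t * ?b t * (?X t + ?Y t) \<le> ?a t * ?b t * (4 * ln (1 / (?a t * ?b t)))"
      using p by (intro mult_left_mono) auto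
    then show ?thesis by (simp only: ac_simps)
  qed (simp only: mult_zero_left)
  then have "(\<Sum>t\<in>I. ?a t * ?b t * (?X t + ?Y t)) \<le> 4 * (\<Sum>t\<in>I. ?a t * ?b t * ln (1 / (?a t * ?b t)))"
    unfolding sum_distrib_left by (intro sum_mono)
  also have "\<dots> \<le> 4 * ln (card I)"
    using fin nn sum_avg_mult_avg[OF fin(2,3) one]
    by (intro mult_left_mono entropy_le_ln_card) auto
  finally show ?thesis .
qed

text \<open>Information is bounded for a fixed split \<open>d\<close>, whereas the gap concerns a
  fixed coordinate \<open>i\<close>; these identities exchange the two orders of choice.\<close>

lemma sum_Pow_split:
  fixes h :: "'a set \<Rightarrow> 'a \<Rightarrow> real"
  assumes "finite U"
  shows "(\<Sum>d\<in>Pow U. \<Sum>i\<in>d. h d i) = (\<Sum>i\<in>U. \<Sum>d\<in>Pow (U - {i}). h (insert i d) i)"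
    and "(\<Sum>d\<in>Pow U. \<Sum>i\<in>U - d. h d i) = (\<Sum>i\<in>U. \<Sum>d\<in>Pow (U - {i}). h d i)"
proof -
  have Ui: "Pow U = Pow (insert i (U - {i}))" if "i \<in> U" for i
    using that by (simp add: insert_absorb)
  have "(\<Sum>d\<in>Pow U. \<Sum>i\<in>d. h d i) = (\<Sum>d\<in>Pow U. \<Sum>i\<in>U. if i \<in> d then h d i else 0)"
    using assms by (intro sum.cong[OF refl] sum.mono_neutral_cong_left) auto
  also have "\<dots> = (\<Sum>i\<in>U. \<Sum>d\<in>Pow U. if i \<in> d then h d i else 0)"
    by (rule sum.swap)
  also have "\<dots> = (\<Sum>i\<in>U. \<Sum>d\<in>Pow (U - {i}). h (insert i d) i)"
  proof (rule sum.cong[OF refl])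
    fix i assume "i \<in> U"
    then show "(\<Sum>d\<in>Pow U. if i \<in> d then h d i else 0) = (\<Sum>d\<in>Pow (U - {i}). h (insert i d) i)"
      unfolding Ui[OF \<open>i \<in> U\<close>] using assms
      by (subst sum_Pow_insert) (auto intro!: sum.neutral)
  qed
  finally show "(\<Sum>d\<in>Pow U. \<Sum>i\<in>d. h d i) = (\<Sum>i\<in>U. \<Sum>d\<in>Pow (U - {i}). h (insert i d) i)" .
  have "(\<Sum>d\<in>Pow U. \<Sum>i\<in>U - d. h d i) = (\<Sum>d\<in>Pow U. \<Sum>i\<in>U. if i \<in> d then 0 else h d i)"
    using assms by (intro sum.cong[OF refl] sum.mono_neutral_cong_left) auto
  also have "\<dots> = (\<Sum>i\<in>U. \<Sum>d\<in>Pow U. if i \<in> d then 0 else h d i)"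
    by (rule sum.swap)
  also have "\<dots> = (\<Sum>i\<in>U. \<Sum>d\<in>Pow (U - {i}). h d i)"
  proof (rule sum.cong[OF refl])
    fix i assume "i \<in> U"
    then show "(\<Sum>d\<in>Pow U. if i \<in> d then 0 else h d i) = (\<Sum>d\<in>Pow (U - {i}). h d i)"
      unfolding Ui[OF \<open>i \<in> U\<close>] using assms
      by (subst sum_Pow_insert) (auto intro!: sum.cong)
  qed
  finally show "(\<Sum>d\<in>Pow U. \<Sum>i\<in>U - d. h d i) = (\<Sum>i\<in>U. \<Sum>d\<in>Pow (U - {i}). h d i)" .
qed

text \<open>\<open>P\<close> maps a pair of inputs to the transcript and \<open>rect\<close> says that its fibres are rectangles.
  In the hard distribution a set \<open>d\<close> of coordinates is given to the first player and the rest to the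
  second one; each player receives a uniform subset of its own coordinates, so the inputs are
  disjoint. Planting a random \<open>i\<close> in both inputs makes them intersect in exactly one point.\<close>
lemma disjointness_lower_bound:
  fixes P :: "'a set \<Rightarrow> 'a set \<Rightarrow> 't" and acc :: "'t \<Rightarrow> bool"
  assumes U: "finite U" and I: "finite I" "\<And>x y. P x y \<in> I"
    and rect: "\<And>x y x' y'. P x y = P x' y' \<Longrightarrow> P x y' = P x y"
    and gap: "(\<Sum>i\<in>U. \<Sum>d\<in>Pow (U - {i}). \<Sum>x\<in>Pow d. \<Sum>y\<in>Pow (U - {i} - d).
        of_bool (acc (P x y)) - of_bool (acc (P (insert i x) (insert i y))) :: real)
      \<ge> real (card U) * 4 ^ (card U - 1) / 3"
  shows "real (card U) \<le> 1152 * ln (card I)"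
proof (cases "U = {}")
  case True
  have "card I > 0" using I by (auto simp: card_gt_0_iff)
  then show ?thesis using True by simp
next
  case False
  define N where "N = card U - 1"
  have cU: "card U = Suc N" using U False by (simp add: N_def card_gt_0_iff)
  define A where "A t = {x. \<exists>y. P x y = t}" for t
  define B where "B t = {y. \<exists>x. P x y = t}" for t
  have AB: "indicator (A t) x * indicator (B t) y = (of_bool (P x y = t) :: real)" for t x y
  proof -
    have "x \<in> A t \<and> y \<in> B t \<longleftrightarrow> P x y = t"
    proof
      assume "x \<in> A t \<and> y \<in> B t"
      then obtain x' y' where "P x y' = t" "P x' y = t" by (auto simp: A_def B_def)
      then show "P x y = t" using rect[of x y' x' y] by simp
    qed (auto simp: A_def B_def)
    then show ?thesis by (auto simp: indicator_def)
  qed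
  have pick: "(\<Sum>t\<in>I. c t * (of_bool (P x y = t))) = (c (P x y) :: real)" for c x y
    using I by (subst sum.mono_neutral_right[of I "{P x y}"]) auto
  \<comment> \<open>Densities of the two sides of the rectangle of \<open>t\<close> when the bit at
    \<open>i\<close> is 0 or 1. With complementary sets for the remaining coordinates, a product
    such as \<open>\<alpha>1\<close> times \<open>\<beta>0\<close> is the probability of
    \<open>t\<close> for the bit pair (1,0) at \<open>i\<close>.\<close>
  define \<alpha>0 \<alpha>1 \<beta>0 \<beta>1 where
    "\<alpha>0 d t = avg d (indicator (A t))"
    "\<alpha>1 d i t = avg d (\<lambda>x. indicator (A t) (insert i x))"
    "\<beta>0 d t = avg d (indicator (B t))"
    "\<beta>1 d i t = avg d (\<lambda>x. indicator (B t) (insert i x))" for d i t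
  note defs = this
  have nn: "\<alpha>0 d t \<ge> 0" "\<alpha>1 d i t \<ge> 0" "\<beta>0 d t \<ge> 0" "\<beta>1 d i t \<ge> 0" for d i t
    by (auto simp: defs intro!: avg_nonneg)
  define w where "w a b = ((a - b) / (a + b))\<^sup>2" for a b :: real
  define \<eta> where "\<eta> i d = (\<Sum>t\<in>I. \<beta>0 (U - {i} - d) t * ((\<alpha>1 d i t - \<alpha>0 d t)\<^sup>2 / (\<alpha>1 d i t + \<alpha>0 d t)) +
      \<alpha>0 d t * ((\<beta>1 (U - {i} - d) i t - \<beta>0 (U - {i} - d) t)\<^sup>2 /
        (\<beta>1 (U - {i} - d) i t + \<beta>0 (U - {i} - d) t)))" for i d
  \<comment> \<open>What the transcript reveals about bit \<open>i\<close> if it is owned by the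
    first player (\<open>hA\<close>) or the second (\<open>hB\<close>).\<close>
  define hA where "hA d i = (\<Sum>t\<in>I. \<alpha>0 d t * \<beta>0 (U - d) t * w (\<alpha>1 (d - {i}) i t) (\<alpha>0 (d - {i}) t))" for d i
  define hB where "hB d i = (\<Sum>t\<in>I. \<alpha>0 d t * \<beta>0 (U - d) t * w (\<beta>1 (U - d - {i}) i t) (\<beta>0 (U - d - {i}) t))" for d i
  have info: "(\<Sum>i\<in>d. hA d i) + (\<Sum>i\<in>U - d. hB d i) \<le> 4 * ln (card I)" if "d \<in> Pow U" for d
  proof -
    have "finite d" using that U finite_subset by auto
    moreover have "(\<Sum>t\<in>I. indicator (A t) x * indicator (B t) y :: real) = 1" for x y
      using pick[of "\<lambda>_. 1" x y] by (simp add: AB)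
    ultimately have "(\<Sum>t\<in>I. \<alpha>0 d t * \<beta>0 (U - d) t * ((\<Sum>i\<in>d. w (\<alpha>1 (d - {i}) i t) (\<alpha>0 (d - {i}) t)) +
        (\<Sum>i\<in>U - d. w (\<beta>1 (U - d - {i}) i t) (\<beta>0 (U - d - {i}) t)))) \<le> 4 * ln (card I)"
      unfolding defs w_def using I U by (intro information_bound) auto
    moreover have "(\<Sum>i\<in>d. hA d i) = (\<Sum>t\<in>I. \<alpha>0 d t * \<beta>0 (U - d) t * (\<Sum>i\<in>d. w (\<alpha>1 (d - {i}) i t) (\<alpha>0 (d - {i}) t)))"
      unfolding hA_def sum_distrib_left by (rule sum.swap)
    moreover have "(\<Sum>i\<in>U - d. hB d i) = (\<Sum>t\<in>I. \<alpha>0 d t * \<beta>0 (U - d) t * (\<Sum>i\<in>U - d. w (\<beta>1 (U - d - {i}) i t) (\<beta>0 (U - d - {i}) t)))"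
      unfolding hB_def sum_distrib_left by (rule sum.swap)
    ultimately show ?thesis by (simp add: distrib_left sum.distrib)
  qed
  have half: "(s / 2) * w r s' = ((r - s')\<^sup>2 / s) / 2" if "s = r + s'" for s r s' :: real
    using that by (cases "s = 0") (auto simp: w_def power2_eq_square)
  \<comment> \<open>The splits \<open>insert i d\<close> and \<open>d\<close> differ only in the
    owner of \<open>i\<close>. The owner's density is the mean of its two restrictions; this cancels
    one denominator in \<open>w\<close> and leaves the factor 1/2.\<close>
  have \<eta>: "hA (insert i d) i + hB d i = \<eta> i d / 2" if "i \<in> U" "d \<in> Pow (U - {i})" for i d
  proof -
    have d: "finite d" "i \<notin> d" "insert i d - {i} = d" "U - insert i d = U - {i} - d"
      "U - d - {i} = U - {i} - d" "U - d = insert i (U - {i} - d)"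
      using that U finite_subset by auto
    have a: "\<alpha>0 (insert i d) t = (\<alpha>1 d i t + \<alpha>0 d t) / 2" for t
      using d by (simp add: defs avg_insert)
    have b: "\<beta>0 (U - d) t = (\<beta>1 (U - {i} - d) i t + \<beta>0 (U - {i} - d) t) / 2" for t
      unfolding d(6) using U by (simp add: defs avg_insert)
    have "hA (insert i d) i = (\<Sum>t\<in>I. \<beta>0 (U - {i} - d) t *
        ((\<alpha>1 d i t + \<alpha>0 d t) / 2 * w (\<alpha>1 d i t) (\<alpha>0 d t)))"
      unfolding hA_def d a by (simp only: ac_simps)
    moreover have "hB d i = (\<Sum>t\<in>I. \<alpha>0 d t *
        ((\<beta>1 (U - {i} - d) i t + \<beta>0 (U - {i} - d) t) / 2 *
         w (\<beta>1 (U - {i} - d) i t) (\<beta>0 (U - {i} - d) t)))"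
      unfolding hB_def b d(5) by (simp only: ac_simps)
    ultimately show ?thesis
      unfolding half[OF refl] \<eta>_def by (simp add: sum.distrib sum_divide_distrib add_divide_distrib)
  qed
  have "(\<Sum>i\<in>U. \<Sum>d\<in>Pow (U - {i}). \<eta> i d / 2) =
      (\<Sum>i\<in>U. \<Sum>d\<in>Pow (U - {i}). hA (insert i d) i + hB d i)"
    using \<eta> by (intro sum.cong) auto
  also have "\<dots> = (\<Sum>d\<in>Pow U. (\<Sum>i\<in>d. hA d i) + (\<Sum>i\<in>U - d. hB d i))"
    using sum_Pow_split[OF U] by (simp add: sum.distrib)
  also have "\<dots> \<le> (\<Sum>d\<in>Pow U. 4 * ln (card I))"
    by (intro sum_mono info)
  also have "\<dots> = 2 ^ N * (8 * ln (card I))"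
    using U cU by (simp add: card_Pow)
  finally have sum\<eta>: "(\<Sum>i\<in>U. \<Sum>d\<in>Pow (U - {i}). \<eta> i d) \<le> 2 ^ N * (16 * ln (card I))"
    by (simp flip: sum_divide_distrib)
  have local_gap: "(\<Sum>x\<in>Pow d. \<Sum>y\<in>Pow (U - {i} - d).
        of_bool (acc (P x y)) - of_bool (acc (P (insert i x) (insert i y))) :: real)
      \<le> 2 ^ N * (1 / 6 + 12 * \<eta> i d)" if "i \<in> U" "d \<in> Pow (U - {i})" for i d
  proof -
    let ?e = "U - {i} - d"
    have fin: "finite d" "finite ?e" using that U finite_subset by auto
    have "card d + card ?e = N"
    proof -
      have "card (U - {i}) = N" using that U by (simp add: cU)
      moreover have "card (U - {i}) = card d + card ?e"
        using that fin by (metis Pow_iff card_Diff_subset card_mono U finite_Diff le_add_diff_inverse)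
      ultimately show ?thesis by simp
    qed
    note q = avg_mult_avg_eq_sum[where I=I and S=d and S'="?e", unfolded this]
    have s: "(\<Sum>t\<in>I. \<alpha>0 d t * \<beta>0 ?e t) = 1" "(\<Sum>t\<in>I. \<alpha>1 d i t * \<beta>1 ?e i t) = 1"
       "(\<Sum>t\<in>I. \<alpha>1 d i t * \<beta>0 ?e t) = 1" "(\<Sum>t\<in>I. \<alpha>0 d t * \<beta>1 ?e i t) = 1"
      unfolding defs using I fin pick[of "\<lambda>_. 1"]
      by (auto intro!: sum_avg_mult_avg simp: AB)
    have "(\<Sum>x\<in>Pow d. \<Sum>y\<in>Pow ?e. of_bool (acc (P x y)) :: real) =
        2 ^ N * (\<Sum>t\<in>I. of_bool (acc t) * (\<alpha>0 d t * \<beta>0 ?e t))"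
      unfolding defs by (rule q) (simp only: AB pick)
    moreover have "(\<Sum>x\<in>Pow d. \<Sum>y\<in>Pow ?e. of_bool (acc (P (insert i x) (insert i y))) :: real) =
        2 ^ N * (\<Sum>t\<in>I. of_bool (acc t) * (\<alpha>1 d i t * \<beta>1 ?e i t))"
      unfolding defs by (rule q) (simp only: AB pick)
    ultimately have "(\<Sum>x\<in>Pow d. \<Sum>y\<in>Pow ?e.
        of_bool (acc (P x y)) - of_bool (acc (P (insert i x) (insert i y))) :: real) =
        2 ^ N * (\<Sum>t\<in>I. of_bool (acc t) * (\<alpha>0 d t * \<beta>0 ?e t - \<alpha>1 d i t * \<beta>1 ?e i t))"
      by (simp only: sum_subtractf right_diff_distrib)
    also have "\<dots> \<le> 2 ^ N * (\<Sum>t\<in>I. \<bar>\<alpha>0 d t * \<beta>0 ?e t - \<alpha>1 d i t * \<beta>1 ?e i t\<bar>)"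
      by (intro mult_left_mono sum_mono) auto
    also have "\<dots> \<le> 2 ^ N * (1 / 6 + 12 * \<eta> i d)"
      unfolding \<eta>_def by (intro mult_left_mono cut_and_paste_bound nn s) auto
    finally show ?thesis .
  qed
  \<comment> \<open>Of the gap 1/3 the cut-and-paste bound consumes 1/6. What remains is card U / 6
    <= 12 * 16 * ln (card I), whence 1152 = 6 * 192.\<close>
  have "real (card U) * 4 ^ N / 3 \<le> (\<Sum>i\<in>U. \<Sum>d\<in>Pow (U - {i}). 2 ^ N * (1 / 6 + 12 * \<eta> i d))"
    using gap unfolding N_def[symmetric] by (rule order_trans) (intro sum_mono local_gap)
  also have "\<dots> = 2 ^ N * ((\<Sum>i\<in>U. \<Sum>d\<in>Pow (U - {i}). 1 / 6) + 12 * (\<Sum>i\<in>U. \<Sum>d\<in>Pow (U - {i}). \<eta> i d))"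
    by (simp only: sum.distrib flip: sum_distrib_left)
  also have "(\<Sum>i\<in>U. \<Sum>d\<in>Pow (U - {i}). 1 / 6 :: real) = card U * 2 ^ N / 6"
    using U cU by (simp add: card_Pow algebra_simps)
  also have "2 ^ N * (card U * 2 ^ N / 6 + 12 * (\<Sum>i\<in>U. \<Sum>d\<in>Pow (U - {i}). \<eta> i d))
      \<le> 2 ^ N * (card U * 2 ^ N / 6 + 12 * (2 ^ N * (16 * ln (card I))))"
    using sum\<eta> by (intro mult_left_mono add_left_mono) auto
  also have "\<dots> = 4 ^ N * (card U / 6 + 192 * ln (card I))"
    by (simp add: algebra_simps flip: power_mult_distrib)
  finally have "4 ^ N * (real (card U) / 3) \<le> 4 ^ N * (card U / 6 + 192 * ln (card I))"
    by (simp add: ac_simps)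
  then show ?thesis by simp
qed

section \<open>The radius gadget\<close>

lemma relpowp_gdist: "(E ^^ k) u v \<Longrightarrow> (E ^^ gdist E u v) u v"
  unfolding gdist_def by (rule LeastI)

lemma gdist_le: "(E ^^ k) u v \<Longrightarrow> gdist E u v \<le> k"
  unfolding gdist_def by (rule Least_le)

text \<open>Each step of a walk raises the potential by at most one. The assumption
  \<open>conn\<close> guarantees that the \<open>LEAST\<close> in \<open>gdist\<close> is attained
  by a walk.\<close>

lemma potential_le_gdist:
  fixes \<phi> :: "nat \<Rightarrow> nat"
  assumes lip: "\<And>a b. E a b \<Longrightarrow> \<phi> b \<le> \<phi> a + 1" and conn: "(E ^^ k) u v"
  shows "\<phi> v \<le> \<phi> u + gdist E u v"
proof -
  have "(E ^^ j) u z \<Longrightarrow> \<phi> z \<le> \<phi> u + j" for j z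
  proof (induction j arbitrary: z)
    case (Suc j)
    then show ?case using lip by fastforce
  qed simp
  then show ?thesis using relpowp_gdist[OF conn] by blast
qed

text \<open>The adjacencies \<open>RowA i - ColA j\<close> encode the first input \<open>x\<close>, the adjacencies
  \<open>RowB i - ColB j\<close> the second input \<open>y\<close>. Only \<open>RowA\<close> nodes can have eccentricity 3, because all
  other nodes are at distance at least 4 from one of the two \<open>End\<close> nodes; and \<open>RowA i\<close> reaches
  everything but \<open>RowB i\<close> within 3 steps, which it reaches in 3 steps only along
  \<open>RowA i - ColA j - ColB j - RowB i\<close> with \<open>(i, j) \<in> x \<inter> y\<close>.\<close>
datatype node = RowA nat | RowB nat | ColA nat | ColB nat | Mid nat | Hub
  | Gate bool | Link bool | End bool

definition nodes :: "nat \<Rightarrow> node set" where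
  "nodes m = RowA ` {..<m} \<union> RowB ` {..<m} \<union> ColA ` {..<m} \<union> ColB ` {..<m} \<union> Mid ` {..<m}
     \<union> {Hub} \<union> range Gate \<union> range Link \<union> range End"

lemma finite_nodes: "finite (nodes m)"
  by (simp add: nodes_def)

lemma card_nodes_le: "card (nodes m) \<le> 5 * m + 7"
proof -
  have r: "range Gate = {Gate True, Gate False}" "range Link = {Link True, Link False}"
    "range End = {End True, End False}" by (auto simp: UNIV_bool)
  have "card (range Gate \<union> range Link \<union> range End) \<le> 6" unfolding r by (simp add: card_insert_if)
  moreover have "card (f ` {..<m}) \<le> m" for f :: "nat \<Rightarrow> node"
    using card_image_le[of "{..<m}" f] by simp
  note this[of RowA] this[of RowB] this[of ColA] this[of ColB] this[of Mid]
  moreover have "card (A \<union> B) \<le> a + b" if "card A \<le> a" "card B \<le> b" for A B :: "node set" and a b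
    using that card_Un_le[of A B] by linarith
  note un = this
  ultimately have "card (RowA ` {..<m} \<union> RowB ` {..<m} \<union> ColA ` {..<m} \<union> ColB ` {..<m} \<union> Mid ` {..<m}
     \<union> {Hub} \<union> (range Gate \<union> range Link \<union> range End)) \<le> m + m + m + m + m + 1 + 6"
    by (intro un) auto
  then show ?thesis by (simp add: nodes_def Un_assoc)
qed

text \<open>Each edge is listed in one orientation only. \<open>Mid j\<close> puts
  \<open>RowB j\<close> at distance 2 from every \<open>RowA i\<close> except i = j. There are two
  \<open>Gate\<close>-\<open>Link\<close>-\<open>End\<close> paths so that the nodes of one are far
  from the end of the other.\<close>

definition arc :: "(nat \<times> nat) set \<Rightarrow> (nat \<times> nat) set \<Rightarrow> node \<Rightarrow> node \<Rightarrow> bool" where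
  "arc x y p q = (case p of
      RowA i \<Rightarrow> (case q of ColA j \<Rightarrow> (i, j) \<in> x | Mid j \<Rightarrow> i \<noteq> j | _ \<Rightarrow> False)
    | RowB i \<Rightarrow> (case q of ColB j \<Rightarrow> (i, j) \<in> y | Mid j \<Rightarrow> i = j | _ \<Rightarrow> False)
    | ColA i \<Rightarrow> (case q of ColB j \<Rightarrow> i = j | _ \<Rightarrow> False)
    | Hub \<Rightarrow> (case q of RowA _ \<Rightarrow> True | ColA _ \<Rightarrow> True | _ \<Rightarrow> False)
    | Gate b \<Rightarrow> (case q of RowA _ \<Rightarrow> True | Link b' \<Rightarrow> b = b' | _ \<Rightarrow> False)
    | Link b \<Rightarrow> (case q of End b' \<Rightarrow> b = b' | _ \<Rightarrow> False)
    | _ \<Rightarrow> False)"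

definition adj :: "(nat \<times> nat) set \<Rightarrow> (nat \<times> nat) set \<Rightarrow> node \<Rightarrow> node \<Rightarrow> bool" where
  "adj x y p q \<longleftrightarrow> arc x y p q \<or> arc x y q p"

lemma ex_surj_nodes:
  assumes "5 * m + 7 \<le> n"
  obtains dec where "dec ` {1..n} = nodes m"
proof -
  have "card (nodes m) \<le> card {1..n}" using card_nodes_le[of m] assms by simp
  then obtain f where f: "f ` nodes m \<subseteq> {1..n}" "inj_on f (nodes m)"
    using card_le_inj[of "nodes m" "{1..n}"] finite_nodes by auto
  \<comment> \<open>Surplus vertices become copies of \<open>Hub\<close>.\<close>
  define dec where "dec v = (if v \<in> f ` nodes m then inv_into (nodes m) f v else Hub)" for v
  have "dec v \<in> nodes m" for v
    by (auto simp: dec_def inv_into_into) (auto simp: nodes_def)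
  moreover have "z \<in> dec ` {1..n}" if "z \<in> nodes m" for z
    using that f by (intro image_eqI[of _ _ "f z"]) (auto simp: dec_def)
  ultimately show ?thesis by (intro that[of dec]) auto
qed

text \<open>An arbitrary surjection onto the nodes takes care of any number of vertices: surplus
  vertices become non-adjacent twins, which does not affect any of the distances that matter.\<close>
locale radius_gadget =
  fixes n m :: nat and dec :: "nat \<Rightarrow> node"
  assumes m: "m \<ge> 3" and dec: "dec ` {1..n} = nodes m"
begin

definition gr :: "(nat \<times> nat) set \<Rightarrow> (nat \<times> nat) set \<Rightarrow> nat \<Rightarrow> nat \<Rightarrow> bool" where
  "gr x y u v \<longleftrightarrow> u \<in> {1..n} \<and> v \<in> {1..n} \<and> adj x y (dec u) (dec v)"

definition enc :: "node \<Rightarrow> nat" where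
  "enc z = (SOME v. v \<in> {1..n} \<and> dec v = z)"

lemma enc: "z \<in> nodes m \<Longrightarrow> enc z \<in> {1..n}" "z \<in> nodes m \<Longrightarrow> dec (enc z) = z"
proof -
  assume "z \<in> nodes m"
  then have "\<exists>v. v \<in> {1..n} \<and> dec v = z" unfolding dec[symmetric] by auto
  from someI_ex[OF this] show "enc z \<in> {1..n}" "dec (enc z) = z" by (auto simp: enc_def)
qed

lemma dec_in_nodes: "v \<in> {1..n} \<Longrightarrow> dec v \<in> nodes m"
  using dec by auto

lemma gr_sym: "gr x y u v \<Longrightarrow> gr x y v u"
  by (auto simp: gr_def adj_def)

lemma graph_on_gr: "graph_on n (gr x y)"
proof -
  have "\<not> adj x y z z" for z by (cases z) (auto simp: arc_def adj_def)
  then show ?thesis by (auto simp: graph_on_def gr_def adj_def)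
qed

text \<open>This locality makes a broadcast algorithm a two-party protocol; vertices exempt from
  both case conditions can be simulated by either player.\<close>

lemma nbrs_gr_cong:
  "(case dec v of RowB _ \<Rightarrow> False | ColB _ \<Rightarrow> False | _ \<Rightarrow> True) \<Longrightarrow> nbrs (gr x y) v = nbrs (gr x y') v"
  "(case dec v of RowA _ \<Rightarrow> False | ColA _ \<Rightarrow> False | _ \<Rightarrow> True) \<Longrightarrow> nbrs (gr x y) v = nbrs (gr x' y) v"
proof -
  assume *: "case dec v of RowB _ \<Rightarrow> False | ColB _ \<Rightarrow> False | _ \<Rightarrow> True"
  have "adj x y (dec v) z = adj x y' (dec v) z" for z
    using * by (cases "dec v"; cases z) (auto simp: arc_def adj_def)
  then show "nbrs (gr x y) v = nbrs (gr x y') v" by (simp add: nbrs_def gr_def)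
next
  assume *: "case dec v of RowA _ \<Rightarrow> False | ColA _ \<Rightarrow> False | _ \<Rightarrow> True"
  have "adj x y (dec v) z = adj x' y (dec v) z" for z
    using * by (cases "dec v"; cases z) (auto simp: arc_def adj_def)
  then show "nbrs (gr x y) v = nbrs (gr x' y) v" by (simp add: nbrs_def gr_def)
qed

lemma walk_Suc:
  assumes "(gr x y ^^ k) u (enc p)" "p \<in> nodes m" "v \<in> {1..n}" "adj x y p (dec v)"
  shows "(gr x y ^^ Suc k) u v"
proof -
  have "gr x y (enc p) v" using assms enc[of p] by (auto simp: gr_def)
  then show ?thesis using assms(1) by auto
qed

lemma walk_Suc_enc:
  assumes "(gr x y ^^ k) u (enc p)" "p \<in> nodes m" "q \<in> nodes m" "adj x y p q"
  shows "(gr x y ^^ Suc k) u (enc q)"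
  using walk_Suc[OF assms(1,2)] enc[of q] assms by auto

lemma walks_from_RowA:
  assumes i: "i < m" and v: "v \<in> {1..n}"
  shows "\<exists>k \<le> (if dec v = RowB i then 4 else 3). (gr x y ^^ k) (enc (RowA i)) v"
proof -
  let ?a = "enc (RowA i)"
  \<comment> \<open>A third row index allows detours through \<open>Mid\<close>; this is where
    \<open>m \<ge> 3\<close> enters.\<close>
  have other: "\<exists>l<m. l \<noteq> i \<and> l \<noteq> j" for j
  proof -
    have "\<not> {..<m} \<subseteq> {i, j}"
      using m card_mono[of "{i, j}" "{..<m}"] card_insert_le_m1[of 2 "{j}" i] by auto
    then show ?thesis by auto
  qed
  obtain k where k: "k < m" "k \<noteq> i" using other by auto
  obtain l where l: "l < m" "l \<noteq> i" "l \<noteq> k" using other by auto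
  have w0: "(gr x y ^^ 0) ?a ?a" by simp
  have nRow: "RowA j \<in> nodes m" if "j < m" for j using that by (auto simp: nodes_def)
  have nMid: "Mid j \<in> nodes m" if "j < m" for j using that by (auto simp: nodes_def)
  have nCol: "ColA j \<in> nodes m" if "j < m" for j using that by (auto simp: nodes_def)
  have nHub: "Hub \<in> nodes m" "Gate b \<in> nodes m" "Link b \<in> nodes m" for b by (auto simp: nodes_def)
  note w1 = walk_Suc_enc[OF w0 nRow[OF i]]
  have h: "(gr x y ^^ Suc 0) ?a (enc Hub)" by (rule w1) (auto simp: arc_def adj_def nHub)
  have g: "(gr x y ^^ Suc 0) ?a (enc (Gate b))" for b by (rule w1) (auto simp: arc_def adj_def nHub)
  have g2: "(gr x y ^^ Suc (Suc 0)) ?a (enc (Link b))" for b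
    by (rule walk_Suc_enc[OF g]) (auto simp: arc_def adj_def nHub)
  have f: "(gr x y ^^ Suc 0) ?a (enc (Mid j))" if "j < m" "j \<noteq> i" for j
    by (rule w1) (use that in \<open>auto simp: arc_def adj_def nMid\<close>)
  have ak: "(gr x y ^^ Suc (Suc 0)) ?a (enc (RowA k))"
    by (rule walk_Suc_enc[OF f[OF l(1,2)]]) (use k l in \<open>auto simp: arc_def adj_def nMid nRow\<close>)
  \<comment> \<open>\<open>Mid i\<close> is not adjacent to \<open>RowA i\<close>; the route is
    \<open>RowA i\<close>, \<open>Mid l\<close>, \<open>RowA k\<close>, \<open>Mid i\<close>, and
    one more step leads to \<open>RowB i\<close>.\<close>
  have fi: "(gr x y ^^ Suc (Suc (Suc 0))) ?a (enc (Mid i))"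
    by (rule walk_Suc_enc[OF ak]) (use k i in \<open>auto simp: arc_def adj_def nMid nRow\<close>)
  have "dec v \<in> nodes m" using dec_in_nodes v .
  note walk = walk_Suc[OF _ _ v]
  show ?thesis
  proof (cases "dec v")
    case (RowA j)
    obtain l' where l': "l' < m" "l' \<noteq> i" "l' \<noteq> j" using other by auto
    have "(gr x y ^^ Suc (Suc 0)) ?a v"
      by (rule walk[OF f[OF l'(1,2)]]) (use l' RowA in \<open>auto simp: arc_def adj_def nMid\<close>)
    then show ?thesis by (intro exI[of _ "Suc (Suc 0)"]) auto
  next
    case (RowB j)
    then have j: "j < m" using \<open>dec v \<in> nodes m\<close> by (auto simp: nodes_def)
    show ?thesis
    proof (cases "j = i")
      case True
      have "(gr x y ^^ Suc (Suc (Suc (Suc 0)))) ?a v"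
        by (rule walk[OF fi]) (use RowB True i in \<open>auto simp: arc_def adj_def nMid\<close>)
      then show ?thesis using RowB True by (intro exI[of _ "Suc (Suc (Suc (Suc 0)))"]) auto
    next
      case False
      have "(gr x y ^^ Suc (Suc 0)) ?a v"
        by (rule walk[OF f[OF j False]]) (use RowB j in \<open>auto simp: arc_def adj_def nMid\<close>)
      then show ?thesis by (intro exI[of _ "Suc (Suc 0)"]) auto
    qed
  next
    case (ColA j)
    have "(gr x y ^^ Suc (Suc 0)) ?a v"
      by (rule walk[OF h]) (use ColA in \<open>auto simp: arc_def adj_def nHub\<close>)
    then show ?thesis by (intro exI[of _ "Suc (Suc 0)"]) auto
  next
    case (ColB j)
    then have j: "j < m" using \<open>dec v \<in> nodes m\<close> by (auto simp: nodes_def)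
    have "(gr x y ^^ Suc (Suc 0)) ?a (enc (ColA j))"
      by (rule walk_Suc_enc[OF h]) (use j in \<open>auto simp: arc_def adj_def nHub nCol\<close>)
    then have "(gr x y ^^ Suc (Suc (Suc 0))) ?a v"
      by (rule walk) (use ColB j in \<open>auto simp: arc_def adj_def nCol\<close>)
    then show ?thesis by (intro exI[of _ "Suc (Suc (Suc 0))"]) auto
  next
    case (Mid j)
    show ?thesis
    proof (cases "j = i")
      case True
      have "(gr x y ^^ Suc (Suc (Suc 0))) ?a v"
        by (rule walk[OF ak]) (use Mid True k in \<open>auto simp: arc_def adj_def nRow\<close>)
      then show ?thesis by (intro exI[of _ "Suc (Suc (Suc 0))"]) auto
    next
      case False
      have "(gr x y ^^ Suc 0) ?a v"
        by (rule walk[OF w0]) (use Mid False i in \<open>auto simp: arc_def adj_def nRow\<close>)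
      then show ?thesis by (intro exI[of _ "Suc 0"]) auto
    qed
  next
    case Hub
    have "(gr x y ^^ Suc 0) ?a v"
      by (rule walk[OF w0]) (use Hub i in \<open>auto simp: arc_def adj_def nRow\<close>)
    then show ?thesis by (intro exI[of _ "Suc 0"]) auto
  next
    case (Gate b)
    have "(gr x y ^^ Suc 0) ?a v"
      by (rule walk[OF w0]) (use Gate i in \<open>auto simp: arc_def adj_def nRow\<close>)
    then show ?thesis by (intro exI[of _ "Suc 0"]) auto
  next
    case (Link b)
    have "(gr x y ^^ Suc (Suc 0)) ?a v"
      by (rule walk[OF g]) (use Link in \<open>auto simp: arc_def adj_def nHub\<close>)
    then show ?thesis by (intro exI[of _ "Suc (Suc 0)"]) auto
  next
    case (End b)
    have "(gr x y ^^ Suc (Suc (Suc 0))) ?a v"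
      by (rule walk[OF g2]) (use End in \<open>auto simp: arc_def adj_def nHub\<close>)
    then show ?thesis by (intro exI[of _ "Suc (Suc (Suc 0))"]) auto
  qed
qed

lemma relpowp_gr_sym: "(gr x y ^^ k) u v \<Longrightarrow> (gr x y ^^ k) v u"
proof (induction k arbitrary: v)
  case (Suc k)
  then obtain w where "(gr x y ^^ k) u w" "gr x y w v" by auto
  then show ?case using Suc.IH gr_sym relpowp_Suc_I2 by metis
qed simp

lemma walk_ex:
  assumes "u \<in> {1..n}" "v \<in> {1..n}"
  shows "\<exists>k. (gr x y ^^ k) u v"
proof -
  have "0 < m" using m by simp
  then obtain k l where "(gr x y ^^ k) (enc (RowA 0)) u" "(gr x y ^^ l) (enc (RowA 0)) v"
    using walks_from_RowA assms by blast
  then have "(gr x y ^^ (k + l)) u v"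
    using relpowp_gr_sym unfolding relpowp_add by blast
  then show ?thesis ..
qed

lemma connected_gr: "connected_graph n (gr x y)"
  using walk_ex by (auto simp: connected_graph_def)

lemma radius_le_3:
  assumes ij: "i < m" "j < m" "(i, j) \<in> x" "(i, j) \<in> y"
  shows "radius n (gr x y) \<le> 3"
proof -
  let ?a = "enc (RowA i)"
  have nd: "RowA i \<in> nodes m" "ColA j \<in> nodes m" "ColB j \<in> nodes m"
    using ij by (auto simp: nodes_def)
  have a: "?a \<in> {1..n}" using nd enc by blast
  have "gdist (gr x y) ?a v \<le> 3" if v: "v \<in> {1..n}" for v
  proof (cases "dec v = RowB i")
    case True
    have "(gr x y ^^ 0) ?a ?a" by simp
    from walk_Suc_enc[OF this nd(1,2)] have "(gr x y ^^ Suc 0) ?a (enc (ColA j))"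
      using ij by (simp add: arc_def adj_def)
    from walk_Suc_enc[OF this nd(2,3)] have "(gr x y ^^ Suc (Suc 0)) ?a (enc (ColB j))"
      by (simp add: arc_def adj_def)
    from walk_Suc[OF this nd(3) v] have "(gr x y ^^ Suc (Suc (Suc 0))) ?a v"
      using ij True by (simp add: arc_def adj_def)
    from gdist_le[OF this] show ?thesis by simp
  next
    case False
    then obtain k where "k \<le> 3" "(gr x y ^^ k) ?a v"
      using walks_from_RowA[OF ij(1) v, of x y] by auto
    then show ?thesis using gdist_le[of k "gr x y" ?a v] by simp
  qed
  then have "ecc n (gr x y) ?a \<le> 3"
    unfolding ecc_def using a by (subst Max_le_iff) auto
  moreover have "radius n (gr x y) \<le> ecc n (gr x y) ?a"
    unfolding radius_def using a by (intro Min_le) auto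
  ultimately show ?thesis by simp
qed

lemma ecc_ge_potential:
  fixes \<phi> :: "node \<Rightarrow> nat"
  assumes lip: "\<And>p q. arc x y p q \<Longrightarrow> \<phi> q \<le> \<phi> p + 1 \<and> \<phi> p \<le> \<phi> q + 1"
    and u: "u \<in> {1..n}" "\<phi> (dec u) = 0" and z: "z \<in> nodes m" "\<phi> z = 4"
  shows "ecc n (gr x y) u \<ge> 4"
proof -
  obtain k where "(gr x y ^^ k) u (enc z)" using walk_ex u enc z by blast
  then have "\<phi> (dec (enc z)) \<le> \<phi> (dec u) + gdist (gr x y) u (enc z)"
    by (rule potential_le_gdist[rotated]) (use lip in \<open>auto simp: gr_def adj_def\<close>)
  then have "4 \<le> gdist (gr x y) u (enc z)" using u z enc by simp
  also have "\<dots> \<le> ecc n (gr x y) u"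
    unfolding ecc_def using enc[OF z(1)] by (intro Max_ge) auto
  finally show ?thesis .
qed

text \<open>Every walk from such a vertex to \<open>End b\<close> must enter through some
  \<open>RowA\<close> and then traverse \<open>Gate b\<close> and \<open>Link b\<close>; the
  potential counts these stages.\<close>

lemma ecc_ge_End:
  assumes u: "u \<in> {1..n}" and "\<And>i. dec u \<noteq> RowA i"
    and "dec u \<noteq> Gate b" "dec u \<noteq> Link b" "dec u \<noteq> End b"
  shows "ecc n (gr x y) u \<ge> 4"
proof -
  define \<phi> :: "node \<Rightarrow> nat" where "\<phi> z = (case z of RowA _ \<Rightarrow> 1 | Gate b' \<Rightarrow> (if b' = b then 2 else 0)
     | Link b' \<Rightarrow> (if b' = b then 3 else 0) | End b' \<Rightarrow> (if b' = b then 4 else 0) | _ \<Rightarrow> 0)" for z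
  show ?thesis
  proof (rule ecc_ge_potential[where \<phi>=\<phi> and z="End b"])
    show "\<phi> q \<le> \<phi> p + 1 \<and> \<phi> p \<le> \<phi> q + 1" if "arc x y p q" for p q
      using that by (cases p; cases q) (auto simp: arc_def \<phi>_def)
    show "\<phi> (dec u) = 0" using assms by (cases "dec u") (auto simp: \<phi>_def)
  qed (use u in \<open>auto simp: \<phi>_def nodes_def\<close>)
qed

lemma ecc_ge_RowA:
  assumes u: "u \<in> {1..n}" "dec u = RowA i" and disj: "x \<inter> y = {}"
  shows "ecc n (gr x y) u \<ge> 4"
proof -
  have i: "i < m" using dec_in_nodes[OF u(1)] u(2) by (auto simp: nodes_def)
  \<comment> \<open>If \<open>(i, j) \<in> y\<close>, then \<open>ColB j\<close> is adjacent to
    \<open>RowB i\<close> and needs value 3, which forces 2 at \<open>ColA j\<close>. This is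
    harmless since disjointness excludes the edge from \<open>RowA i\<close>, of value 0, to
    \<open>ColA j\<close>.\<close>
  define \<phi> :: "node \<Rightarrow> nat" where "\<phi> z = (case z of RowA k \<Rightarrow> (if k = i then 0 else 2)
     | RowB k \<Rightarrow> (if k = i then 4 else 2) | Mid k \<Rightarrow> (if k = i then 3 else 1)
     | ColA j \<Rightarrow> (if (i, j) \<in> y then 2 else 1) | ColB j \<Rightarrow> (if (i, j) \<in> y then 3 else 2)
     | _ \<Rightarrow> 1)" for z
  show ?thesis
  proof (rule ecc_ge_potential[where \<phi>=\<phi> and z="RowB i"])
    show "\<phi> q \<le> \<phi> p + 1 \<and> \<phi> p \<le> \<phi> q + 1" if "arc x y p q" for p q
      using that disj by (cases p; cases q) (auto simp: arc_def \<phi>_def)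
  qed (use i u in \<open>auto simp: \<phi>_def nodes_def\<close>)
qed

lemma radius_ge_4:
  assumes disj: "x \<inter> y = {}"
  shows "radius n (gr x y) \<ge> 4"
proof -
  have "ecc n (gr x y) u \<ge> 4" if u: "u \<in> {1..n}" for u
  proof (cases "\<exists>i. dec u = RowA i")
    case True
    then show ?thesis using ecc_ge_RowA[OF u _ disj] by blast
  next
    case False
    show ?thesis
    \<comment> \<open>The far target is the end of a path that does not contain
      \<open>u\<close>.\<close>
    proof (cases "dec u = Gate True \<or> dec u = Link True \<or> dec u = End True")
      case True
      then show ?thesis using False by (intro ecc_ge_End[OF u, of False]) auto
    next
      case nb: False
      then show ?thesis using False by (intro ecc_ge_End[OF u, of True]) auto
    qed
  qed
  moreover have "enc Hub \<in> {1..n}" by (rule enc) (simp add: nodes_def)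
  ultimately show ?thesis unfolding radius_def by (intro Min.boundedI) auto
qed

end

section \<open>Simulating a broadcast algorithm\<close>

text \<open>The rectangle property, by induction on rounds: given the same history, every node sees
  its neighbourhood from \<open>E\<close> or from \<open>E'\<close>, and both lead to the same
  message.\<close>

lemma transcript_cut_and_paste:
  assumes nb: "\<And>v. v \<in> {1..n} \<Longrightarrow> nbrs E'' v = nbrs E v \<or> nbrs E'' v = nbrs E' v"
    and eq: "transcript A n E s T = transcript A n E' s T"
  shows "transcript A n E'' s T = transcript A n E s T"
  using eq
proof (induction T)
  case (Suc T)
  let ?h = "transcript A n E s T"
  have h: "transcript A n E' s T = ?h" using Suc.prems by (simp add: Let_def)
  then have h'': "transcript A n E'' s T = ?h" using Suc.IH by simp
  have msg: "alg_msg A v (nbrs E v) (s v) ?h = alg_msg A v (nbrs E' v) (s v) ?h" if "v \<in> {1..n}" for v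
    using Suc.prems that unfolding transcript.simps Let_def h by (auto dest: fun_cong[of _ _ v])
  have "alg_msg A v (nbrs E'' v) (s v) ?h = alg_msg A v (nbrs E v) (s v) ?h" if "v \<in> {1..n}" for v
    using nb[OF that] msg[OF that] by auto
  then show ?case by (auto simp: Let_def h'')
qed simp

text \<open>Rounds are functions on all naturals, but take the default 0 outside
  \<open>{1..n}\<close>, so only finitely many are possible.\<close>

lemma transcript_in_lists:
  assumes "\<And>v N r h. v \<in> {1..n} \<Longrightarrow> alg_msg A v N r h < M"
  shows "transcript A n E s T \<in> {h. set h \<subseteq> PiE_dflt {1..n} 0 (\<lambda>_. {..<M}) \<and> length h = T}"
  using assms by (induction T) (auto simp: Let_def PiE_dflt_def)

lemma finite_card_transcripts:
  "finite {h. set h \<subseteq> PiE_dflt {1..n} (0::nat) (\<lambda>_. {..<M::nat}) \<and> length h = T}"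
  "card {h. set h \<subseteq> PiE_dflt {1..n} (0::nat) (\<lambda>_. {..<M::nat}) \<and> length h = T} = (M ^ n) ^ T"
proof -
  have "finite (PiE_dflt {1..n} (0::nat) (\<lambda>_. {..<M::nat}))" by (intro finite_PiE_dflt) auto
  then show "finite {h. set h \<subseteq> PiE_dflt {1..n} (0::nat) (\<lambda>_. {..<M::nat}) \<and> length h = T}"
    "card {h. set h \<subseteq> PiE_dflt {1..n} (0::nat) (\<lambda>_. {..<M::nat}) \<and> length h = T} = (M ^ n) ^ T"
    by (simp_all add: finite_lists_length_eq card_lists_length_eq card_PiE_dflt)
qed

text \<open>Averaging: the expected number of successful instances is at least
  \<open>a * card Q\<close>, so some seed attains it.\<close>

lemma ex_good_seed:
  fixes p :: "'s pmf"
  assumes Q: "finite Q" and prob: "\<And>q. q \<in> Q \<Longrightarrow> measure_pmf.prob p {s. R q s} \<ge> a"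
  shows "\<exists>s. a * real (card Q) \<le> (\<Sum>q\<in>Q. of_bool (R q s))"
proof (rule ccontr)
  assume "\<not> ?thesis"
  then have less: "(\<Sum>q\<in>Q. of_bool (R q s)) < a * card Q" for s by (simp add: not_le)
  have int: "integrable (measure_pmf p) (\<lambda>s. of_bool (R q s) :: real)" for q
    by (rule measure_pmf.integrable_const_bound[of _ 1]) auto
  have "(\<Sum>q\<in>Q. measure_pmf.prob p {s. R q s}) = measure_pmf.expectation p (\<lambda>s. \<Sum>q\<in>Q. of_bool (R q s))"
  proof -
    have "measure_pmf.prob p {s. R q s} = measure_pmf.expectation p (\<lambda>s. of_bool (R q s))" for q
    proof -
      have "(\<lambda>s. of_bool (R q s) :: real) = indicator {s. R q s}" by (auto simp: indicator_def)
      then show ?thesis by simp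
    qed
    then show ?thesis by (simp add: int)
  qed
  also have "\<dots> < a * card Q"
    by (rule measure_pmf.expectation_less) (use less int in auto)
  finally have "(\<Sum>q\<in>Q. measure_pmf.prob p {s. R q s}) < (\<Sum>q\<in>Q. a)" by (simp add: mult.commute)
  moreover have "(\<Sum>q\<in>Q. a) \<le> (\<Sum>q\<in>Q. measure_pmf.prob p {s. R q s})"
    using prob by (intro sum_mono)
  ultimately show False by simp
qed

text \<open>Support of the hard distribution, flattened into one finite set for the averaging over
  seeds: planted coordinate, split, and the two inputs.\<close>

definition quads :: "'a set \<Rightarrow> ('a \<times> 'a set \<times> 'a set \<times> 'a set) set" where
  "quads U = (SIGMA i:U. SIGMA d:Pow (U - {i}). Pow d \<times> Pow (U - {i} - d))"

lemma sum_quads: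
  assumes U: "finite U"
  shows "(\<Sum>(i, d, x, y)\<in>quads U. g i d x y :: real) =
    (\<Sum>i\<in>U. \<Sum>d\<in>Pow (U - {i}). \<Sum>x\<in>Pow d. \<Sum>y\<in>Pow (U - {i} - d). g i d x y)"
proof -
  have fin: "finite d" if "d \<subseteq> U - {i}" for d i using that U finite_subset by auto
  have "(\<Sum>i\<in>U. \<Sum>d\<in>Pow (U - {i}). \<Sum>x\<in>Pow d. \<Sum>y\<in>Pow (U - {i} - d). g i d x y) =
      (\<Sum>i\<in>U. \<Sum>d\<in>Pow (U - {i}). \<Sum>(x, y)\<in>Pow d \<times> Pow (U - {i} - d). g i d x y)"
    by (simp only: sum.cartesian_product)
  also have "\<dots> = (\<Sum>i\<in>U. \<Sum>(d, x, y)\<in>(SIGMA d:Pow (U - {i}). Pow d \<times> Pow (U - {i} - d)). g i d x y)"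
    using U fin by (intro sum.cong[OF refl], subst sum.Sigma) (auto simp: case_prod_unfold)
  also have "\<dots> = (\<Sum>(i, d, x, y)\<in>quads U. g i d x y)"
    unfolding quads_def using U fin
    by (subst sum.Sigma) (auto simp: case_prod_unfold intro!: finite_SigmaI)
  finally show ?thesis by simp
qed

lemma finite_quads: "finite U \<Longrightarrow> finite (quads U)"
  unfolding quads_def by (intro finite_SigmaI) (auto intro: finite_subset)

text \<open>Every coordinate other than the planted one has an owner and a bit, hence four
  choices.\<close>

lemma card_quads:
  assumes U: "finite U"
  shows "real (card (quads U)) = card U * 4 ^ (card U - 1)"
proof -
  have "real (card (quads U)) = (\<Sum>(i, d, x, y)\<in>quads U. 1)" by (simp add: case_prod_unfold)
  also have "\<dots> = (\<Sum>i\<in>U. \<Sum>d\<in>Pow (U - {i}). \<Sum>x\<in>Pow d. \<Sum>y\<in>Pow (U - {i} - d). 1)"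
    by (rule sum_quads[OF U])
  also have "\<dots> = (\<Sum>i\<in>U. \<Sum>d\<in>Pow (U - {i}). 2 ^ (card U - 1))"
  proof (intro sum.cong refl)
    fix i d assume "i \<in> U" and d: "d \<in> Pow (U - {i})"
    have fin: "finite d" "finite (U - {i} - d)" using d U finite_subset by auto
    have "card (U - {i} - d) = card (U - {i}) - card d" "card d \<le> card (U - {i})"
      using d fin U by (auto intro: card_Diff_subset card_mono)
    then have "card d + card (U - {i} - d) = card U - 1" using U \<open>i \<in> U\<close> by simp
    then show "(\<Sum>x\<in>Pow d. \<Sum>y\<in>Pow (U - {i} - d). 1 :: real) = 2 ^ (card U - 1)"
      using fin by (simp add: card_Pow flip: power_add)
  qed
  also have "\<dots> = card U * (2 ^ (card U - 1) * 2 ^ (card U - 1))"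
    using U by (simp add: card_Pow)
  finally show ?thesis by (simp flip: power_mult_distrib)
qed

section \<open>Reduction from disjointness to radius approximation\<close>

context radius_gadget
begin

lemma gr_cut_and_paste:
  "transcript A n (gr x y) s T = transcript A n (gr x' y') s T \<Longrightarrow>
   transcript A n (gr x y') s T = transcript A n (gr x y) s T"
proof (rule transcript_cut_and_paste)
  fix v
  show "nbrs (gr x y') v = nbrs (gr x y) v \<or> nbrs (gr x y') v = nbrs (gr x' y') v"
    using nbrs_gr_cong(1)[of v x y' y] nbrs_gr_cong(2)[of v x y' x'] by (cases "dec v") auto
qed

lemma square_le_transcript_length:
  fixes M :: nat
  assumes \<epsilon>: "0 < \<epsilon>" "\<epsilon> \<le> 1 / 3" and M: "M > 0"
    and msg: "\<And>v N r h. v \<in> {1..n} \<Longrightarrow> alg_msg A v N r h < M"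
    and approx: "bcc_radius_approx n (4 / 3 - \<epsilon>) A T"
  shows "real (m * m) \<le> 1152 * (real T * real n * ln M)"
proof -
  define U where "U = {..<m} \<times> {..<m}"
  have U: "finite U" "card U = m * m" by (auto simp: U_def)
  define ok where "ok E s \<longleftrightarrow> (\<forall>v\<in>{1..n}. let Rt = alg_out A v (nbrs E v) (s v) (transcript A n E s T)
      in real (radius n E) \<le> Rt \<and> Rt \<le> (4 / 3 - \<epsilon>) * real (radius n E))" for E s
  \<comment> \<open>The flag selects the disjoint pair or the same pair with \<open>i\<close>
    planted in both inputs.\<close>
  define Gr where "Gr = (\<lambda>((i, d :: (nat \<times> nat) set, x, y), b). if b then gr x y else gr (insert i x) (insert i y))"
  have "\<exists>s. 2 / 3 * real (card (quads U \<times> (UNIV :: bool set))) \<le> (\<Sum>q\<in>quads U \<times> UNIV. of_bool (ok (Gr q) s))"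
  proof (rule ex_good_seed)
    show "finite (quads U \<times> (UNIV :: bool set))" using finite_quads[OF U(1)] by simp
    fix q
    have "graph_on n (Gr q) \<and> connected_graph n (Gr q)"
      by (auto simp: Gr_def graph_on_gr connected_gr split: prod.splits)
    then show "2 / 3 \<le> measure_pmf.prob (seeds n A) {s. ok (Gr q) s}"
      using approx unfolding bcc_radius_approx_def ok_def by blast
  qed
  then obtain s where s: "4 / 3 * real (card (quads U)) \<le> (\<Sum>q\<in>quads U \<times> (UNIV :: bool set). of_bool (ok (Gr q) s))"
    by (auto simp: card_cartesian_product)
  \<comment> \<open>The neighbourhood of this vertex depends on neither input, so with the seed
    fixed its output is a function of the transcript alone.\<close>
  define v0 where "v0 = enc Hub"
  have "Hub \<in> nodes m" by (simp add: nodes_def)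
  then have v0: "v0 \<in> {1..n}" "dec v0 = Hub" unfolding v0_def by (rule enc)+
  define N0 where "N0 = nbrs (gr {} {}) v0"
  have nb: "nbrs (gr x y) v0 = N0" for x y
    using nbrs_gr_cong(1)[of v0 x y "{}"] nbrs_gr_cong(2)[of v0 x "{}" "{}"] v0(2) by (simp add: N0_def)
  define acc where "acc h \<longleftrightarrow> alg_out A v0 N0 (s v0) h \<ge> 4" for h
  define P where "P x y = transcript A n (gr x y) s T" for x y
  have ok_bounds: "real (radius n (gr x y)) \<le> alg_out A v0 N0 (s v0) (P x y) \<and>
      alg_out A v0 N0 (s v0) (P x y) \<le> (4 / 3 - \<epsilon>) * real (radius n (gr x y))"
    if "ok (gr x y) s" for x y
    using that[unfolded ok_def, rule_format, OF v0(1)] by (simp add: P_def nb Let_def)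
  have ok_acc: "ok (gr x y) s \<Longrightarrow> acc (P x y)" if "x \<inter> y = {}" for x y
    using radius_ge_4[OF that] ok_bounds[of x y] by (auto simp: acc_def)
  have ok_not_acc: "ok (gr x y) s \<Longrightarrow> \<not> acc (P x y)" if "(i, j) \<in> x" "(i, j) \<in> y" "i < m" "j < m" for x y i j
  proof -
    assume "ok (gr x y) s"
    then have "alg_out A v0 N0 (s v0) (P x y) \<le> (4 / 3 - \<epsilon>) * real (radius n (gr x y))"
      using ok_bounds by blast
    also have "\<dots> \<le> (4 / 3 - \<epsilon>) * 3"
      using radius_le_3[OF that(3,4,1,2)] \<epsilon> by (intro mult_left_mono) auto
    also have "\<dots> < 4" using \<epsilon> by simp
    finally show ?thesis by (simp add: acc_def)
  qed
  \<comment> \<open>A correct run accepts the disjoint pair and rejects the planted one, so the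
    successes number at most 1 plus the difference in acceptance. The average is at least 4/3, which
    leaves the gap 1/3.\<close>
  have pt: "(\<Sum>b\<in>UNIV. of_bool (ok (Gr (q, b)) s)) \<le>
      (case q of (i, d, x, y) \<Rightarrow> (1 + (of_bool (acc (P x y)) - of_bool (acc (P (insert i x) (insert i y)))) :: real))"
    if "q \<in> quads U" for q
  proof -
    obtain i j d x y where q: "q = ((i, j), d, x, y)" by (metis prod.collapse)
    have "x \<inter> y = {}" "i < m" "j < m" using that by (auto simp: q quads_def U_def)
    moreover have "(\<Sum>b\<in>UNIV. f b) = f True + f False" for f :: "bool \<Rightarrow> real"
      by (simp add: UNIV_bool)
    ultimately show ?thesis
      using ok_acc[of x y] ok_not_acc[of i j "insert (i, j) x" "insert (i, j) y"]
      by (auto simp: q Gr_def simp del: sum_of_bool_eq)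
  qed
  have "4 / 3 * real (card (quads U)) \<le> (\<Sum>q\<in>quads U. \<Sum>b\<in>UNIV. of_bool (ok (Gr (q, b)) s))"
    using s unfolding sum.cartesian_product by (simp only: case_prod_unfold prod.collapse)
  also have "\<dots> \<le> (\<Sum>q\<in>quads U. case q of (i, d, x, y) \<Rightarrow>
      (1 + (of_bool (acc (P x y)) - of_bool (acc (P (insert i x) (insert i y)))) :: real))"
    by (intro sum_mono pt)
  also have "\<dots> = card (quads U) + (\<Sum>(i, d, x, y)\<in>quads U.
      of_bool (acc (P x y)) - of_bool (acc (P (insert i x) (insert i y))) :: real)"
    by (simp add: case_prod_unfold sum.distrib)
  finally have gap: "real (card U) * 4 ^ (card U - 1) / 3 \<le> (\<Sum>i\<in>U. \<Sum>d\<in>Pow (U - {i}). \<Sum>x\<in>Pow d. \<Sum>y\<in>Pow (U - {i} - d).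
        of_bool (acc (P x y)) - of_bool (acc (P (insert i x) (insert i y))) :: real)"
    unfolding sum_quads[OF U(1)] card_quads[OF U(1)] by simp
  have "real (card U) \<le> 1152 * ln (real ((M ^ n) ^ T))"
    unfolding finite_card_transcripts(2)[symmetric, of M n T]
  proof (rule disjointness_lower_bound[OF U(1) finite_card_transcripts(1) _ _ gap])
    show "P x y \<in> {h. set h \<subseteq> PiE_dflt {1..n} 0 (\<lambda>_. {..<M}) \<and> length h = T}" for x y
      unfolding P_def by (rule transcript_in_lists[OF msg])
    show "P x y = P x' y' \<Longrightarrow> P x y' = P x y" for x y x' y'
      unfolding P_def by (rule gr_cut_and_paste)
  qed
  then show ?thesis using M by (simp add: U ln_realpow)
qed

end

theorem theorem29:
  fixes \<epsilon> :: real
  assumes "0 < \<epsilon>" and "\<epsilon> \<le> 1/3"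
  shows "\<forall>c>0. \<exists>C>0. \<exists>k::nat. \<exists>n0::nat. \<forall>n\<ge>n0. \<forall>A T.
           bcc_bandwidth c n A \<and> bcc_radius_approx n (4/3 - \<epsilon>) A T
           \<longrightarrow> real T \<ge> C * real n / (ln (real n)) ^ k"
proof (intro allI impI)
  fix c :: real assume c: "c > 0"
  \<comment> \<open>Here 115200 = 100 * 1152, with 100 from \<open>n \<le> 10 * m\<close> squared
    and 1 + c from the bound on \<open>ln M\<close>.\<close>
  define C where "C = 1 / (115200 * (1 + c))"
  have "real T \<ge> C * real n / ln (real n) ^ 1"
    if n: "n \<ge> 30" and A: "bcc_bandwidth c n A" "bcc_radius_approx n (4/3 - \<epsilon>) A T" for n A T
  proof -
    define m where "m = (n - 7) div 5"
    have nm: "n \<le> 10 * m" and m7: "5 * m + 7 \<le> n" and m3: "m \<ge> 3" using n by (auto simp: m_def)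
    obtain dec where dec: "dec ` {1..n} = nodes m" using ex_surj_nodes[OF m7] .
    interpret radius_gadget n m dec by unfold_locales (use m3 dec in auto)
    have ln_n: "ln (real n) > 0" using n by simp
    define M where "M = nat \<lceil>real n powr c\<rceil>"
    have nc: "real n powr c \<ge> 1" using n c by (simp add: ge_one_powr_ge_zero)
    have M: "M > 0" using nc n by (simp add: M_def)
    have eq: "2 powr (c * log 2 (real n)) = real n powr c"
      using n by (simp add: powr_def log_def)
    have msg: "alg_msg A v N r h < M" if "v \<in> {1..n}" for v N r h
    proof -
      have "real (alg_msg A v N r h) < real n powr c"
        using A(1) that unfolding bcc_bandwidth_def eq by blast
      also have "\<dots> \<le> M" unfolding M_def by (rule real_nat_ceiling_ge)
      finally show ?thesis by simp
    qed
    \<comment> \<open>The rounding in \<open>M\<close> is absorbed by one extra factor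
      \<open>n\<close>.\<close>
    have "real M \<le> real n powr c + 1" unfolding M_def using nc by linarith
    also have "\<dots> \<le> real n * real n powr c"
    proof -
      have "2 * real n powr c \<le> real n * real n powr c" using n by (intro mult_right_mono) auto
      then show ?thesis using nc by linarith
    qed
    finally have "ln (real M) \<le> ln (real n * real n powr c)" using M by simp
    also have "\<dots> = (1 + c) * ln (real n)" using n by (simp add: ln_mult ln_powr algebra_simps)
    finally have lnM: "ln (real M) \<le> (1 + c) * ln (real n)" .
    have "real n * real n \<le> (10 * real m) * (10 * real m)"
      using nm by (intro mult_mono) linarith+
    also have "\<dots> = 100 * real (m * m)" by simp
    also have "\<dots> \<le> 100 * (1152 * (real T * real n * ln M))"
      using square_le_transcript_length[OF assms M msg A(2)] by simp
    also have "\<dots> \<le> 100 * (1152 * (real T * real n * ((1 + c) * ln (real n))))"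
      using lnM by (intro mult_left_mono) auto
    finally have "real n * real n \<le> real n * (115200 * (1 + c) * real T * ln (real n))"
      by (simp add: algebra_simps)
    then have "real n \<le> 115200 * (1 + c) * real T * ln (real n)"
      using n by simp
    then have "real n / (115200 * (1 + c) * ln (real n)) \<le> real T"
      using ln_n c by (subst pos_divide_le_eq) (auto simp: ac_simps)
    then show ?thesis by (simp add: C_def)
  qed
  moreover have "C > 0" using c by (simp add: C_def)
  ultimately show "\<exists>C>0. \<exists>k::nat. \<exists>n0::nat. \<forall>n\<ge>n0. \<forall>A T.
           bcc_bandwidth c n A \<and> bcc_radius_approx n (4/3 - \<epsilon>) A T
           \<longrightarrow> real T \<ge> C * real n / (ln (real n)) ^ k"
    by blast
qed

end
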